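(* Let $R$ be a multiplication ring with finitely many minimal prime ideals. Then an $R$-module $M$ is faithful, Noetherian and distributive if and only if $M$ is a faithful multiplication $R$-module.
   Context: All rings are commutative with $1$ and all modules are unital. A ring $R$ is a multiplication ring if whenever $I,J$ are ideals of $R$ with $J\subseteq I$, there is an ideal $I'$ of $R$ with $J=I'I$. An $R$-module $M$ is a multiplication module if every submodule of $M$ equals $IM$ for some ideal $I$ of $R$. A submodule $N$ of $M$ is distributive if $(M_1+M_2)\cap N=M_1\cap N+M_2\cap N$ for all submodules $M_1,M_2$ of $M$; $M$ is distributive if all its submodules are distributive. $M$ is faithful if $\mathrm{ann}_R(M)=0$. *)

theory Defs
  imports Main "HOL.Modules"
begin

text \<open>Rings: a type of class comm_ring_1. Modules: a type of class ab_group_add together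
  with a scalar multiplication satisfying the module axioms (locale module from HOL.Modules).\<close>

definition ring_ideal :: "'a::comm_ring_1 set \<Rightarrow> bool" where
  "ring_ideal I \<longleftrightarrow> 0 \<in> I \<and> (\<forall>x\<in>I. \<forall>y\<in>I. x + y \<in> I) \<and> (\<forall>r. \<forall>x\<in>I. r * x \<in> I)"

definition submodule :: "('a::comm_ring_1 \<Rightarrow> 'b::ab_group_add \<Rightarrow> 'b) \<Rightarrow> 'b set \<Rightarrow> bool" where
  "submodule scale N \<longleftrightarrow> 0 \<in> N \<and> (\<forall>x\<in>N. \<forall>y\<in>N. x + y \<in> N) \<and> (\<forall>r. \<forall>x\<in>N. scale r x \<in> N)"

definition gen_submodule :: "('a::comm_ring_1 \<Rightarrow> 'b::ab_group_add \<Rightarrow> 'b) \<Rightarrow> 'b set \<Rightarrow> 'b set" where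
  "gen_submodule scale S = {(\<Sum>a\<in>t. scale (c a) a) | t c. finite t \<and> t \<subseteq> S}"

definition ideal_prod :: "'a::comm_ring_1 set \<Rightarrow> 'a set \<Rightarrow> 'a set" where
  "ideal_prod I J = gen_submodule ((*) :: 'a \<Rightarrow> 'a \<Rightarrow> 'a) {i * j | i j. i \<in> I \<and> j \<in> J}"

definition prime_ideal :: "'a::comm_ring_1 set \<Rightarrow> bool" where
  "prime_ideal P \<longleftrightarrow> ring_ideal P \<and> P \<noteq> UNIV \<and> (\<forall>a b. a * b \<in> P \<longrightarrow> a \<in> P \<or> b \<in> P)"

definition minimal_prime_ideal :: "'a::comm_ring_1 set \<Rightarrow> bool" where
  "minimal_prime_ideal P \<longleftrightarrow> prime_ideal P \<and> (\<forall>Q. prime_ideal Q \<and> Q \<subseteq> P \<longrightarrow> Q = P)"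

definition multiplication_ring :: "'a::comm_ring_1 itself \<Rightarrow> bool" where
  "multiplication_ring _ \<longleftrightarrow>
     (\<forall>I J :: 'a set. ring_ideal I \<and> ring_ideal J \<and> J \<subseteq> I \<longrightarrow>
        (\<exists>I'. ring_ideal I' \<and> J = ideal_prod I' I))"

definition ideal_smult :: "('a::comm_ring_1 \<Rightarrow> 'b::ab_group_add \<Rightarrow> 'b) \<Rightarrow> 'a set \<Rightarrow> 'b set" where
  "ideal_smult scale I = gen_submodule scale {scale r m | r m. r \<in> I}"

definition ann_module :: "('a::comm_ring_1 \<Rightarrow> 'b::ab_group_add \<Rightarrow> 'b) \<Rightarrow> 'a set" where
  "ann_module scale = {r. \<forall>m. scale r m = 0}"

definition faithful_module :: "('a::comm_ring_1 \<Rightarrow> 'b::ab_group_add \<Rightarrow> 'b) \<Rightarrow> bool" where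
  "faithful_module scale \<longleftrightarrow> ann_module scale = {0}"

definition multiplication_module :: "('a::comm_ring_1 \<Rightarrow> 'b::ab_group_add \<Rightarrow> 'b) \<Rightarrow> bool" where
  "multiplication_module scale \<longleftrightarrow>
     (\<forall>N. submodule scale N \<longrightarrow> (\<exists>I. ring_ideal I \<and> N = ideal_smult scale I))"

definition noetherian_module :: "('a::comm_ring_1 \<Rightarrow> 'b::ab_group_add \<Rightarrow> 'b) \<Rightarrow> bool" where
  "noetherian_module scale \<longleftrightarrow>
     (\<forall>N :: nat \<Rightarrow> 'b set. (\<forall>i. submodule scale (N i) \<and> N i \<subseteq> N (Suc i)) \<longrightarrow>
        (\<exists>n. \<forall>m\<ge>n. N m = N n))"

definition submod_sum :: "'b::ab_group_add set \<Rightarrow> 'b set \<Rightarrow> 'b set" where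
  "submod_sum A B = {x + y | x y. x \<in> A \<and> y \<in> B}"

definition distributive_submodule :: "('a::comm_ring_1 \<Rightarrow> 'b::ab_group_add \<Rightarrow> 'b) \<Rightarrow> 'b set \<Rightarrow> bool" where
  "distributive_submodule scale N \<longleftrightarrow>
     (\<forall>M1 M2. submodule scale M1 \<and> submodule scale M2 \<longrightarrow>
        submod_sum M1 M2 \<inter> N = submod_sum (M1 \<inter> N) (M2 \<inter> N))"

definition distributive_module :: "('a::comm_ring_1 \<Rightarrow> 'b::ab_group_add \<Rightarrow> 'b) \<Rightarrow> bool" where
  "distributive_module scale \<longleftrightarrow>
     (\<forall>N. submodule scale N \<longrightarrow> distributive_submodule scale N)"

end

theory Submission
  imports Defs
begin

text \<open>
  Over any commutative ring, a Noetherian distributive module satisfies \<open>(Rx : y) + (Ry : x) = R\<close>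
  for all \<open>x\<close> and \<open>y\<close>; being finitely generated it is therefore locally cyclic, and locally
  cyclic finitely generated modules are multiplication modules.

  Conversely, a multiplication ring \<open>R\<close> with finitely many minimal primes is Noetherian. An ideal
  that is not finitely generated vanishes locally at some prime containing it, so a prime that is
  not finitely generated must be minimal; the minimal primes are pairwise comaximal, and together
  with their finiteness this makes each of them finitely generated after all. Chains of submodules
  \<open>N\<close> of a multiplication module are controlled by the ideals \<open>(N : M)\<close>, so \<open>M\<close> is Noetherian;
  and \<open>(I : J) + (J : I) = R\<close> for all ideals of \<open>R\<close>, which passes to cyclic submodules of \<open>M\<close>
  and gives distributivity.
\<close>

section \<open>Ideals as submodules of the ring\<close>

interpretation R: module "(*) :: 'a::comm_ring_1 \<Rightarrow> 'a \<Rightarrow> 'a"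
  by standard (auto simp: algebra_simps)

text \<open>For \<open>scale = (*)\<close> this simp rule is the reverse of associativity and loops with
  \<open>algebra_simps\<close>.\<close>
declare R.scale_scale [simp del]

lemma ring_ideal_iff_subspace: "ring_ideal I \<longleftrightarrow> R.subspace I"
  by (auto simp: ring_ideal_def R.subspace_def)

lemma ring_ideal_span [simp, intro]: "ring_ideal (R.span S)"
  by (simp add: ring_ideal_iff_subspace)

lemma ring_ideal_mult_left: "ring_ideal I \<Longrightarrow> x \<in> I \<Longrightarrow> r * x \<in> I"
  by (simp add: ring_ideal_def)

lemma ring_ideal_add: "ring_ideal I \<Longrightarrow> x \<in> I \<Longrightarrow> y \<in> I \<Longrightarrow> x + y \<in> I"
  by (simp add: ring_ideal_def)

lemma ring_span_least: "S \<subseteq> I \<Longrightarrow> ring_ideal I \<Longrightarrow> R.span S \<subseteq> I"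
  by (simp add: R.span_minimal ring_ideal_iff_subspace)

lemma mem_span_insert_ideal:
  "ring_ideal I \<Longrightarrow> x \<in> R.span (insert a I) \<longleftrightarrow> (\<exists>k. x - k * a \<in> I)"
  by (simp add: R.span_breakdown_eq ring_ideal_iff_subspace R.span_eq_iff[THEN iffD2])

lemma ideal_prod_eq_span: "ideal_prod I J = R.span {i * j | i j. i \<in> I \<and> j \<in> J}"
  by (simp add: ideal_prod_def gen_submodule_def R.span_explicit)

lemma ideal_prod_memI: "i \<in> I \<Longrightarrow> j \<in> J \<Longrightarrow> i * j \<in> ideal_prod I J"
  unfolding ideal_prod_eq_span by (rule R.span_base) auto

lemma ideal_prod_subset:
  assumes "ring_ideal K" "\<And>i j. i \<in> I \<Longrightarrow> j \<in> J \<Longrightarrow> i * j \<in> K"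
  shows "ideal_prod I J \<subseteq> K"
  unfolding ideal_prod_eq_span by (rule ring_span_least) (use assms in auto)

lemma ring_ideal_ideal_prod [simp]: "ring_ideal (ideal_prod I J)"
  by (simp add: ideal_prod_eq_span)

lemma ideal_prod_mono: "I \<subseteq> I' \<Longrightarrow> ideal_prod I J \<subseteq> ideal_prod I' J"
  by (rule ideal_prod_subset) (auto intro: ideal_prod_memI)

lemma ring_ideal_Union_chain:
  assumes "C \<noteq> {}" "subset.chain A C" "\<And>I. I \<in> A \<Longrightarrow> ring_ideal I"
  shows "ring_ideal (\<Union>C)"
proof -
  have id: "ring_ideal I" if "I \<in> C" for I
    using assms that by (auto simp: subset.chain_def)
  have "x + y \<in> \<Union>C" if "x \<in> I" "I \<in> C" "y \<in> J" "J \<in> C" for x y I J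
  proof -
    have "I \<subseteq> J \<or> J \<subseteq> I"
      using assms(2) that by (auto simp: subset_chain_def)
    then show ?thesis
      using that id ring_ideal_add by blast
  qed
  moreover have "r * x \<in> \<Union>C" if "x \<in> I" "I \<in> C" for r x I
    using ring_ideal_mult_left[OF id] that by blast
  moreover have "0 \<in> \<Union>C"
    using id assms(1) by (auto simp: ring_ideal_def)
  ultimately show ?thesis
    unfolding ring_ideal_def by (meson UnionE)
qed

section \<open>Prime ideals, minimal primes and nilpotents\<close>

lemma prime_idealD: "prime_ideal P \<Longrightarrow> a * b \<in> P \<Longrightarrow> a \<in> P \<or> b \<in> P"
  by (auto simp: prime_ideal_def)

lemma prime_ideal_imp_ideal: "prime_ideal P \<Longrightarrow> ring_ideal P"
  by (auto simp: prime_ideal_def)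

lemma one_notin_prime_ideal: "prime_ideal P \<Longrightarrow> 1 \<notin> P"
  unfolding prime_ideal_def ring_ideal_def by (metis UNIV_eq_I mult.right_neutral)

text \<open>Turns \<open>x = t * x\<close> with \<open>t\<close> in a prime \<open>P\<close> into
  local vanishing: \<open>1 - t\<close> annihilates \<open>x\<close> and lies outside
  \<open>P\<close>.\<close>

lemma prime_ideal_complement:
  "prime_ideal P \<Longrightarrow> x \<in> P \<Longrightarrow> 1 - x \<notin> P"
  using one_notin_prime_ideal ring_ideal_add[of P x "1 - x"] prime_ideal_imp_ideal by fastforce

lemma prime_ideal_powerD: "prime_ideal P \<Longrightarrow> x ^ n \<in> P \<Longrightarrow> x \<in> P"
  by (induction n) (auto simp: one_notin_prime_ideal dest: prime_idealD)

text \<open>Krull: an ideal containing \<open>J\<close> and maximal among those disjoint from the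
  multiplicative set \<open>S\<close> is prime.\<close>

lemma ex_prime_ideal_disjoint:
  assumes J: "ring_ideal J" and S: "1 \<in> S" "\<And>a b. a \<in> S \<Longrightarrow> b \<in> S \<Longrightarrow> a * b \<in> S"
    and disj: "J \<inter> S = {}"
  obtains P where "prime_ideal P" "J \<subseteq> P" "P \<inter> S = {}"
proof -
  let ?A = "{I. ring_ideal I \<and> J \<subseteq> I \<and> I \<inter> S = {}}"
  have "\<exists>P\<in>?A. \<forall>X\<in>?A. P \<subseteq> X \<longrightarrow> X = P"
  proof (rule subset_Zorn_nonempty)
    show "?A \<noteq> {}" using J disj by blast
    fix C assume C: "C \<noteq> {}" "subset.chain ?A C"
    then have "C \<subseteq> ?A" by (auto simp: subset.chain_def)
    then show "\<Union>C \<in> ?A"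
      using C ring_ideal_Union_chain[OF C] by blast
  qed
  then obtain P where "P \<in> ?A" and maxA: "\<forall>X\<in>?A. P \<subseteq> X \<longrightarrow> X = P" ..
  then have P: "ring_ideal P" "J \<subseteq> P" "P \<inter> S = {}" by auto
  have max: "X = P" if "ring_ideal X" "J \<subseteq> X" "X \<inter> S = {}" "P \<subseteq> X" for X
    using maxA that by auto
  have meets: "\<exists>k. \<exists>s\<in>S. s - k * a \<in> P" if "a \<notin> P" for a
  proof -
    have "P \<subseteq> R.span (insert a P)" "a \<in> R.span (insert a P)"
      by (auto intro: R.span_base)
    then have "R.span (insert a P) \<inter> S \<noteq> {}"
      using max[of "R.span (insert a P)"] that P(2) by blast
    then show ?thesis using mem_span_insert_ideal[OF P(1)] by blast
  qed
  have "a \<in> P \<or> b \<in> P" if "a * b \<in> P" for a b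
  proof (rule ccontr)
    assume "\<not> (a \<in> P \<or> b \<in> P)"
    then obtain k s l t where st: "s \<in> S" "t \<in> S" "s - k * a \<in> P" "t - l * b \<in> P"
      using meets by meson
    have "s * t = t * (s - k * a) + (k * a) * (t - l * b) + (k * l) * (a * b)"
      by (simp add: algebra_simps)
    then have "s * t \<in> P"
      using st that P(1) by (simp add: ring_ideal_def)
    then show False using S st P(3) by blast
  qed
  moreover have "P \<noteq> UNIV" using P S by blast
  ultimately show ?thesis using that P by (auto simp: prime_ideal_def)
qed

lemma ex_prime_ideal_above:
  assumes "ring_ideal J" "1 \<notin> J"
  obtains P where "prime_ideal P" "J \<subseteq> P"
  using ex_prime_ideal_disjoint[OF assms(1), of "{1}"] assms(2) by auto

text \<open>Zorn's lemma downwards: the intersection of a chain of primes is prime.\<close>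

lemma ex_minimal_prime_below:
  assumes P: "prime_ideal P"
  obtains Q where "minimal_prime_ideal Q" "Q \<subseteq> P"
proof -
  \<comment> \<open>Complements reverse inclusion, so a maximal member here is the complement of a
    minimal prime contained in \<open>P\<close>.\<close>
  let ?A = "{- Q |Q. prime_ideal Q \<and> Q \<subseteq> P}"
  have "\<exists>M\<in>?A. \<forall>X\<in>?A. M \<subseteq> X \<longrightarrow> X = M"
  proof (rule subset_Zorn_nonempty)
    show "?A \<noteq> {}" using P by blast
    fix C assume C: "C \<noteq> {}" "subset.chain ?A C"
    then have pr: "prime_ideal (- X)" "- X \<subseteq> P" if "X \<in> C" for X
      using that by (auto simp: subset.chain_def)
    have lin: "X \<subseteq> Y \<or> Y \<subseteq> X" if "X \<in> C" "Y \<in> C" for X Y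
      using C that by (auto simp: subset_chain_def)
    have "0 \<in> - X" "\<And>x y. x \<in> - X \<Longrightarrow> y \<in> - X \<Longrightarrow> x + y \<in> - X"
      "\<And>r x. x \<in> - X \<Longrightarrow> r * x \<in> - X" if "X \<in> C" for X
      using prime_ideal_imp_ideal[OF pr(1)[OF that]] unfolding ring_ideal_def by blast+
    then have "ring_ideal (- \<Union>C)"
      unfolding ring_ideal_def by simp
    moreover have "a \<in> - \<Union>C \<or> b \<in> - \<Union>C" if ab: "a * b \<in> - \<Union>C" for a b
    proof (rule ccontr)
      assume "\<not> ?thesis"
      then obtain X Y where XY: "X \<in> C" "a \<in> X" "Y \<in> C" "b \<in> Y" by blast
      then obtain Z where "Z \<in> C" "a \<in> Z" "b \<in> Z" using lin by blast
      then show False using prime_idealD[OF pr(1)[of Z], of a b] ab by auto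
    qed
    moreover have "- \<Union>C \<subseteq> P" "- \<Union>C \<noteq> UNIV"
      using C(1) pr(2) P unfolding prime_ideal_def by blast+
    ultimately have "prime_ideal (- \<Union>C)" "- \<Union>C \<subseteq> P"
      unfolding prime_ideal_def by blast+
    then show "\<Union>C \<in> ?A"
      by (intro CollectI exI[of _ "- \<Union>C"]) simp
  qed
  then obtain Q where Q: "prime_ideal Q" "Q \<subseteq> P"
    and "\<forall>X\<in>?A. - Q \<subseteq> X \<longrightarrow> X = - Q" by blast
  then have "Q' = Q" if "prime_ideal Q'" "Q' \<subseteq> Q" for Q'
    using that by blast
  then show ?thesis using that[of Q] Q by (auto simp: minimal_prime_ideal_def)
qed

text \<open>Otherwise some prime avoids the powers of \<open>x\<close>, yet a minimal prime below it
  contains \<open>x\<close>.\<close>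

lemma nilpotent_if_in_minimal_primes:
  fixes x :: "'a::comm_ring_1"
  assumes "\<And>Q. minimal_prime_ideal Q \<Longrightarrow> x \<in> Q"
  obtains n where "x ^ n = 0"
proof (cases "\<exists>n. x ^ n = 0")
  case False
  have mult: "a * b \<in> range ((^) x)" if ab: "a \<in> range ((^) x)" "b \<in> range ((^) x)" for a b
  proof -
    obtain k l where "a = x ^ k" "b = x ^ l" using ab by blast
    then have "a * b = x ^ (k + l)" by (simp add: power_add)
    then show ?thesis by blast
  qed
  have one: "1 \<in> range ((^) x)" by (rule range_eqI[of _ _ 0]) simp
  have ideal: "ring_ideal {0 :: 'a}" by (simp add: ring_ideal_def)
  have disj: "{0} \<inter> range ((^) x) = {}" using False by force
  obtain P where P: "prime_ideal P" "P \<inter> range ((^) x) = {}"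
    by (rule ex_prime_ideal_disjoint[OF ideal one mult disj])
  have "x \<in> range ((^) x)" by (rule range_eqI[of _ _ 1]) simp
  moreover obtain Q where "minimal_prime_ideal Q" "Q \<subseteq> P"
    by (rule ex_minimal_prime_below[OF P(1)])
  then have "x \<in> P" using assms by blast
  ultimately show ?thesis using P(2) by blast
next
  case True
  then show ?thesis using that by blast
qed

section \<open>Finitely generated ideals\<close>

definition fg_ideal :: "'a::comm_ring_1 set \<Rightarrow> bool" where
  "fg_ideal I \<longleftrightarrow> (\<exists>F. finite F \<and> I = R.span F)"

lemma fg_ideal_prod:
  assumes "fg_ideal I" "fg_ideal J"
  shows "fg_ideal (ideal_prod I J)"
proof -
  obtain F G where FG: "finite F" "I = R.span F" "finite G" "J = R.span G"
    using assms by (auto simp: fg_ideal_def)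
  let ?H = "(\<lambda>(f, g). f * g) ` (F \<times> G)"
  have "f * g \<in> R.span ?H" if "f \<in> R.span F" "g \<in> R.span G" for f g
    using that(1)
  proof (induction f rule: R.span_induct_alt)
    case (step c a x)
    have ag: "a * g \<in> R.span ?H"
      using that(2)
    proof (induction g rule: R.span_induct_alt)
      case (step d b y)
      have ab: "a * b \<in> R.span ?H" using step.hyps \<open>a \<in> F\<close> by (intro R.span_base) auto
      have e: "a * (d * b + y) = d * (a * b) + a * y" by (simp add: algebra_simps)
      show ?case unfolding e by (rule R.span_add[OF R.span_scale[OF ab] step.IH])
    qed (simp add: R.span_zero)
    have e: "(c * a + x) * g = c * (a * g) + x * g" by (simp add: algebra_simps)
    show ?case unfolding e by (rule R.span_add[OF R.span_scale[OF ag] step.IH])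
  qed (simp add: R.span_zero)
  then have "ideal_prod I J \<subseteq> R.span ?H"
    using FG by (intro ideal_prod_subset) auto
  moreover have "R.span ?H \<subseteq> ideal_prod I J"
    using FG by (intro ring_span_least) (auto intro!: ideal_prod_memI intro: R.span_base)
  ultimately have "ideal_prod I J = R.span ?H" by (rule subset_antisym)
  moreover have "finite ?H" using FG by simp
  ultimately show ?thesis unfolding fg_ideal_def by (intro exI[of _ ?H] conjI)
qed

section \<open>Ideals of a multiplication ring\<close>

context
  assumes mult_ring: "multiplication_ring TYPE('a::comm_ring_1)"
begin

lemma obtain_ideal_factor:
  fixes I J :: "'a set"
  assumes "ring_ideal I" "ring_ideal J" "J \<subseteq> I"
  obtains K where "ring_ideal K" "J = ideal_prod K I"
  using mult_ring assms unfolding multiplication_ring_def by blast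

text \<open>Plays the role of Nakayama's lemma, without finite generation: writing \<open>(x) = BI\<close>,
  one has \<open>(x) = BI = BAI = A(x)\<close>.\<close>
lemma mem_of_ideal_prod_self:
  fixes I A :: "'a set"
  assumes I: "ring_ideal I" and A: "ring_ideal A" and IA: "I \<subseteq> ideal_prod A I" and x: "x \<in> I"
  obtains a where "a \<in> A" "x = a * x"
proof -
  have "R.span {x} \<subseteq> I" using I x by (intro ring_span_least) auto
  then obtain B where B: "ring_ideal B" "R.span {x} = ideal_prod B I"
    using obtain_ideal_factor[OF I] by blast
  \<comment> \<open>The ideal \<open>A x\<close>. Each \<open>b * (a * j)\<close> equals
    \<open>a * (b * j)\<close> with \<open>b * j\<close> in \<open>(x)\<close>, hence lies in
    it.\<close>
  let ?Ax = "{y. \<exists>a\<in>A. y = a * x}"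
  have Ax: "ring_ideal ?Ax"
  proof -
    have "\<exists>c\<in>A. a * x + b * x = c * x" if "a \<in> A" "b \<in> A" for a b
      using that A ring_ideal_add by (intro bexI[of _ "a + b"]) (auto simp: algebra_simps)
    moreover have "\<exists>c\<in>A. r * (a * x) = c * x" if "a \<in> A" for a r
      using that A ring_ideal_mult_left by (intro bexI[of _ "r * a"]) (auto simp: algebra_simps)
    moreover have "0 \<in> A" using A by (simp add: ring_ideal_def)
    ultimately show ?thesis unfolding ring_ideal_def by force
  qed
  have "b * i \<in> ?Ax" if b: "b \<in> B" and i: "i \<in> I" for b i
  proof -
    have "ideal_prod A I \<subseteq> {y. b * y \<in> ?Ax}"
    proof (rule ideal_prod_subset)
      have "b * y + b * z \<in> ?Ax" if "b * y \<in> ?Ax" "b * z \<in> ?Ax" for y z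
        using Ax that by (rule ring_ideal_add)
      moreover have "b * (r * y) \<in> ?Ax" if "b * y \<in> ?Ax" for r y
        using ring_ideal_mult_left[OF Ax that, of r] by (simp only: mult.left_commute)
      moreover have "0 \<in> ?Ax" using Ax unfolding ring_ideal_def by blast
      ultimately show "ring_ideal {y. b * y \<in> ?Ax}"
        unfolding ring_ideal_def mem_Collect_eq[of _ "\<lambda>y. b * y \<in> ?Ax"]
        by (simp only: distrib_left mult_zero_right) blast
      fix a j assume a: "a \<in> A" and "j \<in> I"
      then have "b * j \<in> R.span {x}" using B b ideal_prod_memI by blast
      then obtain k where "b * j = k * x" by (auto simp: R.span_singleton)
      then have "b * (a * j) = (k * a) * x" by (metis mult.assoc mult.left_commute)
      then show "a * j \<in> {y. b * y \<in> ?Ax}"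
        using A a ring_ideal_mult_left by blast
    qed
    then show ?thesis using i IA by blast
  qed
  then have "R.span {x} \<subseteq> ?Ax"
    unfolding B(2) by (intro ideal_prod_subset Ax)
  then have "x \<in> ?Ax" using R.span_base[of x "{x}"] by blast
  then show ?thesis using that by blast
qed

text \<open>The prime contains \<open>\<theta>(I) = \<Sum>\<^sub>x\<^sub>\<in>\<^sub>I (Rx : I)\<close>, an ideal satisfying \<open>I = \<theta>(I) I\<close>
  that is proper because \<open>I\<close> is not finitely generated.\<close>
lemma not_fg_ideal_obtain_prime:
  fixes I :: "'a set"
  assumes I: "ring_ideal I" and nfg: "\<not> fg_ideal I"
  obtains P where "prime_ideal P" "I \<subseteq> P" "\<And>x. x \<in> I \<Longrightarrow> \<exists>t\<in>P. x = t * x"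
proof -
  \<comment> \<open>The union of the ideals \<open>(Rx : I)\<close>; its span \<open>?T\<close> is
    \<open>\<theta>(I)\<close>.\<close>
  let ?G = "{s. \<exists>x\<in>I. \<forall>i\<in>I. s * i \<in> R.span {x}}"
  let ?T = "R.span ?G"
  have "x * i \<in> R.span {x}" for x i
    unfolding R.span_singleton by (metis mult.commute rangeI)
  then have "I \<subseteq> ?G" by blast
  then have IT: "I \<subseteq> ?T" by (auto intro: R.span_base)
  have "I \<subseteq> ideal_prod ?T I"
  proof
    fix x assume x: "x \<in> I"
    have "R.span {x} \<subseteq> I" using I x by (intro ring_span_least) auto
    then obtain B where B: "ring_ideal B" "R.span {x} = ideal_prod B I"
      using obtain_ideal_factor[OF I] by blast
    have "B \<subseteq> ?G" using B(2) x ideal_prod_memI by blast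
    then have "B \<subseteq> ?T" using R.span_superset by blast
    then have "ideal_prod B I \<subseteq> ideal_prod ?T I"
      by (rule ideal_prod_mono)
    then show "x \<in> ideal_prod ?T I" using B(2) R.span_base[of x "{x}"] by blast
  qed
  then have fix_T: "\<exists>t\<in>?T. x = t * x" if "x \<in> I" for x
    using that by (meson mem_of_ideal_prod_self[OF I ring_ideal_span])
  \<comment> \<open>Each element of \<open>?T\<close> multiplies \<open>I\<close> into an ideal
    generated by finitely many elements of \<open>I\<close>; for 1 this would make \<open>I\<close>
    finitely generated.\<close>
  have "\<exists>F. finite F \<and> F \<subseteq> I \<and> (\<forall>i\<in>I. s * i \<in> R.span F)" if "s \<in> ?T" for s
    using that
  proof (induction s rule: R.span_induct_alt)
    case base
    then show ?case by (intro exI[of _ "{}"]) (auto simp: R.span_zero)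
  next
    case (step c s t)
    then obtain x F where xF: "x \<in> I" "\<forall>i\<in>I. s * i \<in> R.span {x}" "finite F" "F \<subseteq> I"
      "\<forall>i\<in>I. t * i \<in> R.span F" by blast
    have "(c * s + t) * i \<in> R.span (insert x F)" if "i \<in> I" for i
    proof -
      have "s * i \<in> R.span (insert x F)" "t * i \<in> R.span (insert x F)"
        using xF that R.span_mono[of "{x}" "insert x F"] R.span_mono[of F "insert x F"] by blast+
      then have "c * (s * i) + t * i \<in> R.span (insert x F)"
        by (metis R.span_add R.span_scale)
      then show ?thesis by (simp add: algebra_simps)
    qed
    then show ?case using xF by (intro exI[of _ "insert x F"]) auto
  qed
  moreover have "\<not> (\<forall>i\<in>I. 1 * i \<in> R.span F)" if "finite F" "F \<subseteq> I" for F
    using nfg ring_span_least[OF that(2) I] that(1) unfolding fg_ideal_def mult_1 by blast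
  ultimately have "1 \<notin> ?T" by blast
  then obtain P where "prime_ideal P" "?T \<subseteq> P"
    using ex_prime_ideal_above[OF ring_ideal_span] by blast
  then show ?thesis using that IT fix_T by blast
qed

text \<open>Writing \<open>Q = BP\<close>, primality gives \<open>B \<subseteq> Q\<close> because
  \<open>P\<close> has an element outside \<open>Q\<close>; so \<open>Q \<subseteq> PQ\<close>, and
  \<open>mem_of_ideal_prod_self\<close> applies.\<close>

lemma prime_below_prime_fixed:
  fixes P Q :: "'a set"
  assumes P: "prime_ideal P" and Q: "prime_ideal Q" and QP: "Q \<subset> P" and x: "x \<in> Q"
  obtains p where "p \<in> P" "x = p * x"
proof -
  note id = prime_ideal_imp_ideal[OF P] prime_ideal_imp_ideal[OF Q]
  obtain B where B: "ring_ideal B" "Q = ideal_prod B P"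
    using obtain_ideal_factor[OF id] QP by blast
  obtain p where p: "p \<in> P" "p \<notin> Q" using QP by blast
  have "B \<subseteq> Q"
    using p B(2) ideal_prod_memI[of _ B p P] prime_idealD[OF Q] by blast
  then have "ideal_prod B P \<subseteq> ideal_prod P Q"
    by (intro ideal_prod_subset) (simp, metis ideal_prod_memI mult.commute subsetD)
  then show ?thesis
    using mem_of_ideal_prod_self[OF id(2,1) _ x] B(2) that by blast
qed

text \<open>For a minimal prime \<open>Q\<close> below \<open>P\<close>, \<open>x = t * x\<close>
  gives \<open>(1 - t) * x \<in> Q\<close> with \<open>1 - t\<close> outside \<open>Q\<close>; hence
  \<open>P \<subseteq> Q\<close>.\<close>

lemma not_fg_prime_is_minimal:
  fixes P :: "'a set"
  assumes P: "prime_ideal P" and nfg: "\<not> fg_ideal P"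
  shows "minimal_prime_ideal P"
proof -
  obtain Q where Q: "minimal_prime_ideal Q" "Q \<subseteq> P"
    using ex_minimal_prime_below[OF P] .
  then have prQ: "prime_ideal Q" by (simp add: minimal_prime_ideal_def)
  obtain P' where P': "prime_ideal P'" "P \<subseteq> P'" "\<And>x. x \<in> P \<Longrightarrow> \<exists>t\<in>P'. x = t * x"
    using not_fg_ideal_obtain_prime[OF prime_ideal_imp_ideal[OF P] nfg] by blast
  have "x \<in> Q" if "x \<in> P" for x
  proof -
    obtain t where t: "t \<in> P'" "x = t * x" using P'(3)[OF \<open>x \<in> P\<close>] by blast
    then have "(1 - t) * x = 0" by (simp add: left_diff_distrib)
    then have "(1 - t) * x \<in> Q" using prQ by (simp add: prime_ideal_def ring_ideal_def)
    moreover have "1 - t \<notin> Q" using prime_ideal_complement[OF P'(1) t(1)] P' Q by blast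
    ultimately show ?thesis using prime_idealD[OF prQ] by blast
  qed
  then show ?thesis using Q by (metis subsetI subset_antisym)
qed

text \<open>If both lay in a prime \<open>P\<close>, then \<open>x = p * x\<close> with
  \<open>p \<in> P\<close> for an \<open>x\<close> in \<open>Q\<close> but not in \<open>Q'\<close>;
  this puts \<open>1 - p\<close> in \<open>Q'\<close>, hence in \<open>P\<close>.\<close>

lemma minimal_primes_comaximal:
  fixes Q Q' :: "'a set"
  assumes Q: "minimal_prime_ideal Q" and Q': "minimal_prime_ideal Q'" and "Q \<noteq> Q'"
  obtains q where "q \<in> Q" "1 - q \<in> Q'"
proof (rule ccontr)
  assume neg: "\<not> thesis"
  have pr: "prime_ideal Q" "prime_ideal Q'" using Q Q' by (auto simp: minimal_prime_ideal_def)
  have "1 \<notin> R.span (Q \<union> Q')"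
  proof
    assume "1 \<in> R.span (Q \<union> Q')"
    then obtain q q' where "q \<in> Q" "q' \<in> Q'" "1 = q + q'"
      using pr[THEN prime_ideal_imp_ideal] unfolding R.span_Un
      by (auto simp: ring_ideal_iff_subspace R.span_eq_iff[THEN iffD2])
    then show False using neg that[of q] by (metis add_diff_cancel_left')
  qed
  then obtain P where P: "prime_ideal P" "R.span (Q \<union> Q') \<subseteq> P"
    using ex_prime_ideal_above[OF ring_ideal_span] by blast
  then have sub: "Q \<subseteq> P" "Q' \<subseteq> P"
    using R.span_superset[of "Q \<union> Q'"] by blast+
  then have "Q \<subset> P"
    using \<open>Q \<noteq> Q'\<close> Q pr by (auto simp: minimal_prime_ideal_def)
  obtain x where x: "x \<in> Q" "x \<notin> Q'"
    using Q' pr \<open>Q \<noteq> Q'\<close> by (auto simp: minimal_prime_ideal_def)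
  obtain p where p: "p \<in> P" "x = p * x"
    using prime_below_prime_fixed[OF P(1) pr(1) \<open>Q \<subset> P\<close> x(1)] .
  then have "(1 - p) * x = 0" by (simp add: left_diff_distrib)
  then have "(1 - p) * x \<in> Q'" using pr by (simp add: prime_ideal_def ring_ideal_def)
  then have "1 - p \<in> P" using prime_idealD[OF pr(2)] x sub by blast
  then show False using prime_ideal_complement[OF P(1) p(1)] by blast
qed

text \<open>The element \<open>f\<close> is a product of factors \<open>1 - q\<close>, one for each
  other minimal prime \<open>Q'\<close>, with \<open>q \<in> Q\<close> and
  \<open>1 - q \<in> Q'\<close>.\<close>

lemma minimal_prime_separating_element:
  fixes Q :: "'a set"
  assumes Q: "minimal_prime_ideal Q" and fin: "finite {P :: 'a set. minimal_prime_ideal P}"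
  obtains f where "1 - f \<in> Q" "\<And>Q'. minimal_prime_ideal Q' \<Longrightarrow> Q' \<noteq> Q \<Longrightarrow> f \<in> Q'"
proof -
  have idQ: "ring_ideal Q" using Q by (simp add: minimal_prime_ideal_def prime_ideal_def)
  have "\<exists>f. 1 - f \<in> Q \<and> (\<forall>Q'\<in>\<Q>. f \<in> Q')"
    if "finite \<Q>" "\<Q> \<subseteq> {P. minimal_prime_ideal P} - {Q}" for \<Q>
    using that
  proof (induction \<Q>)
    case empty
    then show ?case using idQ by (intro exI[of _ 1]) (auto simp: ring_ideal_def)
  next
    case (insert Q' \<Q>)
    then obtain f where f: "1 - f \<in> Q" "\<forall>Q'\<in>\<Q>. f \<in> Q'" by auto
    obtain q where q: "q \<in> Q" "1 - q \<in> Q'"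
      using minimal_primes_comaximal[OF Q, of Q'] insert.prems by blast
    have ids: "ring_ideal I" if "I \<in> insert Q' \<Q>" for I
      using insert.prems that by (auto simp: minimal_prime_ideal_def prime_ideal_def)
    have e: "1 - f * (1 - q) = (1 - f) + f * q" by (simp add: algebra_simps)
    have "1 - f * (1 - q) \<in> Q"
      unfolding e using idQ f q by (simp add: ring_ideal_add ring_ideal_mult_left)
    moreover have "f * (1 - q) \<in> I" if "I \<in> insert Q' \<Q>" for I
      using ids[OF that] f(2) q(2) that ring_ideal_mult_left[of I f "1 - q"]
        ring_ideal_mult_left[of I "1 - q" f] by (auto simp: mult.commute)
    ultimately show ?case by blast
  qed
  from this[of "{P. minimal_prime_ideal P} - {Q}"] fin show ?thesis using that by blast
qed

text \<open>If \<open>Q\<close> were not finitely generated, it would vanish locally at every prime containing it;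
  with \<open>f\<close> separating \<open>Q\<close> from the other minimal primes and \<open>f\<^sup>k (1 - f)\<^sup>k = 0\<close>, this forces
  \<open>Q\<close> to be generated by \<open>(1 - f)\<^sup>k\<close>.\<close>
lemma minimal_prime_fg:
  fixes Q :: "'a set"
  assumes Q: "minimal_prime_ideal Q" and fin: "finite {P :: 'a set. minimal_prime_ideal P}"
  shows "fg_ideal Q"
proof (rule ccontr)
  assume nfg: "\<not> fg_ideal Q"
  have prQ: "prime_ideal Q" using Q by (simp add: minimal_prime_ideal_def)
  note idQ = prime_ideal_imp_ideal[OF prQ]
  \<comment> \<open>Every \<open>x\<close> in \<open>Q\<close> vanishes locally at \<open>P\<close>:
    for \<open>P = Q\<close> because \<open>Q\<close> is not finitely generated, otherwise because
    \<open>Q\<close> lies properly below \<open>P\<close>.\<close>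
  have loc0: "\<exists>u. u \<notin> P \<and> u * x = 0" if P: "prime_ideal P" "Q \<subseteq> P" and x: "x \<in> Q" for P x
  proof -
    obtain P' t where "prime_ideal P'" "P \<subseteq> P'" "t \<in> P'" "x = t * x"
    proof (cases "P = Q")
      case True
      then show ?thesis
        using not_fg_ideal_obtain_prime[OF idQ nfg] x that by metis
    next
      case False
      then show ?thesis
        using prime_below_prime_fixed[OF P(1) prQ _ x] P that by blast
    qed
    then show ?thesis
      using prime_ideal_complement[of P' t]
      by (intro exI[of _ "1 - t"]) (auto simp: left_diff_distrib)
  qed
  obtain f where f: "1 - f \<in> Q" "\<And>Q'. minimal_prime_ideal Q' \<Longrightarrow> Q' \<noteq> Q \<Longrightarrow> f \<in> Q'"
    using minimal_prime_separating_element[OF Q fin] by blast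
  have "f * (1 - f) \<in> Q'" if "minimal_prime_ideal Q'" for Q'
  proof -
    have "ring_ideal Q'" using that by (simp add: minimal_prime_ideal_def prime_ideal_def)
    then show ?thesis
      using f that ring_ideal_mult_left[of Q' f "1 - f"] ring_ideal_mult_left[of Q' "1 - f" f]
      by (cases "Q' = Q") (auto simp: mult.commute)
  qed
  then obtain n where n: "(f * (1 - f)) ^ n = 0"
    using nilpotent_if_in_minimal_primes by blast
  define g where "g = (1 - f) ^ n"
  define h where "h = f ^ n"
  have gh: "g * h = 0"
    using n by (simp add: g_def h_def power_mult_distrib mult.commute)
  \<comment> \<open>An exponent 0 would give \<open>1 = 0\<close>; a positive one puts
    \<open>(1 - f) ^ n\<close> in \<open>Q\<close>.\<close>
  have "n \<noteq> 0" using n by (cases n) auto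
  then have gQ: "g \<in> Q"
    using ring_ideal_mult_left[OF idQ f(1), of "(1 - f) ^ (n - 1)"] power_minus_mult[of n "1 - f"]
    by (simp add: g_def)
  \<comment> \<open>A prime containing the annihilator of \<open>h * x\<close> contains
    \<open>g\<close>, hence not \<open>f\<close>; so only \<open>Q\<close> can be a minimal prime
    below it, and \<open>loc0\<close> applies.\<close>
  have hx: "h * x = 0" if x: "x \<in> Q" for x
  proof (rule ccontr)
    assume "h * x \<noteq> 0"
    let ?A = "{c. c * (h * x) = 0}"
    have "ring_ideal ?A" by (auto simp: ring_ideal_def distrib_right mult.assoc)
    moreover have "1 \<notin> ?A" using \<open>h * x \<noteq> 0\<close> by simp
    ultimately obtain P where P: "prime_ideal P" "?A \<subseteq> P"
      using ex_prime_ideal_above by blast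
    have "g \<in> ?A" using gh by (simp flip: mult.assoc)
    then have "1 - f \<in> P" using P prime_ideal_powerD unfolding g_def by blast
    then have "f \<notin> P" using prime_ideal_complement[OF P(1), of "1 - f"] by simp
    then have "Q \<subseteq> P" using ex_minimal_prime_below[OF P(1)] f(2) by blast
    then obtain u where u: "u \<notin> P" "u * x = 0" using loc0 P(1) x by blast
    then have "u \<in> ?A" by (simp add: mult.left_commute)
    then show False using u P by blast
  qed
  have "Q \<subseteq> R.span {g}"
  proof (rule subsetI, rule ccontr)
    fix x assume x: "x \<in> Q"
    assume nx: "x \<notin> R.span {g}"
    \<comment> \<open>This ideal contains both \<open>g\<close> and \<open>h\<close>; a prime above
      it would contain \<open>1 - f\<close> and \<open>f\<close>.\<close>
    let ?A = "{c. c * x \<in> R.span {g}}"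
    have "ring_ideal ?A"
      by (auto simp: ring_ideal_def distrib_right mult.assoc R.span_zero intro: R.span_add R.span_scale)
    moreover have "1 \<notin> ?A" using nx by simp
    ultimately obtain P where P: "prime_ideal P" "?A \<subseteq> P"
      using ex_prime_ideal_above by blast
    have "g \<in> ?A" by (auto simp: R.span_singleton mult.commute)
    moreover have "h \<in> ?A" using hx[OF x] by (simp add: R.span_zero)
    ultimately have "1 - f \<in> P" "f \<in> P"
      using P prime_ideal_powerD unfolding g_def h_def by blast+
    then show False using prime_ideal_complement[OF P(1)] by blast
  qed
  moreover have "R.span {g} \<subseteq> Q" using gQ idQ by (intro ring_span_least) auto
  ultimately have "Q = R.span {g}" by blast
  then show False using nfg unfolding fg_ideal_def by blast
qed

text \<open>As in Cohen's theorem, an ideal \<open>I\<close> maximal among those not finitely generated is prime: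
  if \<open>ab \<in> I\<close> with \<open>a, b \<notin> I\<close>, then \<open>K = I + (a)\<close> and \<open>(I : K)\<close> are finitely generated,
  and so is their product \<open>I\<close>.\<close>
lemma every_ideal_fg:
  fixes I :: "'a set"
  assumes fin: "finite {P :: 'a set. minimal_prime_ideal P}" and I: "ring_ideal I"
  shows "fg_ideal I"
proof (rule ccontr)
  assume nfg: "\<not> fg_ideal I"
  let ?A = "{I :: 'a set. ring_ideal I \<and> \<not> fg_ideal I}"
  have "\<exists>P\<in>?A. \<forall>X\<in>?A. P \<subseteq> X \<longrightarrow> X = P"
  proof (rule subset_Zorn_nonempty)
    show "?A \<noteq> {}" using I nfg by blast
    fix C assume C: "C \<noteq> {}" "subset.chain ?A C"
    have "\<not> fg_ideal (\<Union>C)"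
    proof
      assume "fg_ideal (\<Union>C)"
      then obtain F where F: "finite F" "\<Union>C = R.span F" by (auto simp: fg_ideal_def)
      then have "F \<subseteq> \<Union>C" using R.span_superset by blast
      then obtain J where J: "J \<in> C" "F \<subseteq> J"
        using finite_subset_Union_chain[OF F(1) _ C(1)] C(2) by blast
      then have "J \<in> ?A" using C by (auto simp: subset.chain_def)
      moreover have "J = R.span F"
        using J F ring_span_least[of F J] calculation by blast
      ultimately show False using F(1) by (auto simp: fg_ideal_def)
    qed
    then show "\<Union>C \<in> ?A" using ring_ideal_Union_chain[OF C] by blast
  qed
  then obtain P where "P \<in> ?A" and maxA: "\<forall>X\<in>?A. P \<subseteq> X \<longrightarrow> X = P" ..
  then have P: "ring_ideal P" "\<not> fg_ideal P" by auto
  have max: "fg_ideal X" if "ring_ideal X" "P \<subset> X" for X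
    using maxA that by auto
  have "a \<in> P \<or> b \<in> P" if ab: "a * b \<in> P" for a b
  proof (rule ccontr)
    assume neg: "\<not> (a \<in> P \<or> b \<in> P)"
    let ?K = "R.span (insert a P)"
    have PK: "P \<subset> ?K" using neg R.span_superset[of "insert a P"] by blast
    then obtain B where B: "ring_ideal B" "P = ideal_prod B ?K"
      using obtain_ideal_factor[OF ring_ideal_span P(1)] by blast
    \<comment> \<open>This is \<open>(P : K)\<close>. It contains \<open>b\<close> and
      \<open>P\<close>, so maximality makes it finitely generated; it contains the factor
      \<open>B\<close>, so \<open>P = (P : K) K\<close>.\<close>
    let ?B = "{c. \<forall>k\<in>?K. c * k \<in> P}"
    have idB: "ring_ideal ?B"
      using P(1) unfolding ring_ideal_def by (auto simp: distrib_right mult.assoc)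
    have "?K \<subseteq> {k. b * k \<in> P}"
      using ab P(1) unfolding ring_ideal_def
      by (intro ring_span_least)
         (auto simp: ring_ideal_def distrib_left mult.left_commute mult.commute[of b a])
    then have "b \<in> ?B" by blast
    moreover have "P \<subseteq> ?B" using P(1) ring_ideal_mult_left[of P] by (auto simp: mult.commute)
    ultimately have fgB: "fg_ideal ?B" using max[OF idB] neg by blast
    have eq: "P = ideal_prod ?B ?K"
    proof
      have "B \<subseteq> ?B" using B(2) ideal_prod_memI by blast
      then have "ideal_prod B ?K \<subseteq> ideal_prod ?B ?K"
        by (rule ideal_prod_mono)
      then show "P \<subseteq> ideal_prod ?B ?K" using B(2) by blast
      show "ideal_prod ?B ?K \<subseteq> P" using P(1) by (intro ideal_prod_subset) auto
    qed
    have "fg_ideal P"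
      by (subst eq) (rule fg_ideal_prod[OF fgB max[OF ring_ideal_span PK]])
    then show False using P(2) by blast
  qed
  moreover have "P \<noteq> UNIV"
  proof
    assume "P = UNIV"
    then have "P = R.span {1}" by (auto simp: R.span_singleton)
    then show False using P(2) unfolding fg_ideal_def by blast
  qed
  ultimately have "prime_ideal P" using P by (simp add: prime_ideal_def)
  then show False
    using not_fg_prime_is_minimal minimal_prime_fg[OF _ fin] P(2) by blast
qed

text \<open>With \<open>K = I + J\<close>, \<open>I = AK\<close> and \<open>J = BK\<close> one has \<open>K = (A + B)K\<close>, so a finite product of
  elements of \<open>1 + A + B\<close> annihilates \<open>K\<close>.\<close>
lemma ideal_quotients_comaximal:
  fixes I J :: "'a set"
  assumes fin: "finite {P :: 'a set. minimal_prime_ideal P}" and I: "ring_ideal I" and J: "ring_ideal J"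
  obtains a b where "a + b = 1" "\<And>y. y \<in> J \<Longrightarrow> a * y \<in> I" "\<And>x. x \<in> I \<Longrightarrow> b * x \<in> J"
proof -
  let ?K = "R.span (I \<union> J)"
  have sub: "I \<subseteq> ?K" "J \<subseteq> ?K" using R.span_superset[of "I \<union> J"] by blast+
  obtain A where A: "ring_ideal A" "I = ideal_prod A ?K"
    using obtain_ideal_factor[OF ring_ideal_span I sub(1)] .
  obtain B where B: "ring_ideal B" "J = ideal_prod B ?K"
    using obtain_ideal_factor[OF ring_ideal_span J sub(2)] .
  let ?S = "R.span (A \<union> B)"
  have AB: "A \<subseteq> ?S" "B \<subseteq> ?S" using R.span_superset[of "A \<union> B"] by blast+
  have "ideal_prod A ?K \<subseteq> ideal_prod ?S ?K" "ideal_prod B ?K \<subseteq> ideal_prod ?S ?K"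
    using AB by (auto intro: ideal_prod_mono[THEN subsetD])
  then have "I \<union> J \<subseteq> ideal_prod ?S ?K" using A B by blast
  then have "?K \<subseteq> ideal_prod ?S ?K"
    by (rule ring_span_least) simp
  then have fixed: "\<exists>s\<in>?S. x = s * x" if "x \<in> ?K" for x
    using that by (meson mem_of_ideal_prod_self[OF ring_ideal_span ring_ideal_span])
  obtain F where F: "finite F" "?K = R.span F"
    using every_ideal_fg[OF fin ring_ideal_span] by (auto simp: fg_ideal_def)
  have "\<exists>s\<in>?S. \<forall>x\<in>X. (1 - s) * x = 0" if "finite X" "X \<subseteq> ?K" for X
    using that
  proof (induction X)
    case empty
    then show ?case using R.span_zero by blast
  next
    case (insert x X)
    then obtain s where s: "s \<in> ?S" "\<forall>x\<in>X. (1 - s) * x = 0" by auto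
    obtain t where t: "t \<in> ?S" "x = t * x" using fixed insert.prems by blast
    \<comment> \<open>One element can serve several generators, since \<open>1 - s\<close> and
      \<open>1 - t\<close> multiply to \<open>1 - (s + t - s * t)\<close>.\<close>
    have e: "1 - (s + t - s * t) = (1 - s) * (1 - t)" by (simp add: algebra_simps)
    have "(1 - t) * x = 0" using t by (simp add: left_diff_distrib)
    then have "(1 - (s + t - s * t)) * z = 0" if "z \<in> insert x X" for z
      using s(2) that unfolding e
      by (metis insertE mult.assoc mult.left_commute mult_zero_right)
    moreover have "s + t - s * t \<in> ?S"
      using s(1) t(1) by (metis R.span_diff R.span_add R.span_scale)
    ultimately show ?case by blast
  qed
  then obtain s where s: "s \<in> ?S" "\<forall>x\<in>F. (1 - s) * x = 0"
    using F R.span_superset by metis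
  have "?K \<subseteq> {x. (1 - s) * x = 0}"
    unfolding F(2) using s(2)
    by (intro ring_span_least) (auto simp: ring_ideal_def distrib_left mult.left_commute)
  then have ann: "(1 - s) * x = 0" if "x \<in> ?K" for x using that by blast
  obtain a b where ab: "a \<in> A" "b \<in> B" "s = a + b"
    using s(1) A(1) B(1) unfolding R.span_Un
    by (auto simp: ring_ideal_iff_subspace R.span_eq_iff[THEN iffD2])
  show ?thesis
  proof
    \<comment> \<open>The leftover \<open>1 - s\<close> annihilates \<open>I + J\<close>, so adding
      it to \<open>a\<close> makes the sum 1 at no cost.\<close>
    show "(a + (1 - s)) + b = 1" using ab by simp
    show "(a + (1 - s)) * y \<in> I" if "y \<in> J" for y
    proof -
      have "a * y \<in> I" using A(2) ab(1) that sub ideal_prod_memI by blast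
      moreover have "(1 - s) * y = 0" using ann sub that by blast
      ultimately show ?thesis by (simp only: distrib_right add_0_right)
    qed
    show "b * x \<in> J" if "x \<in> I" for x
      using B(2) ab(2) that sub ideal_prod_memI by blast
  qed
qed

text \<open>The union of the chain is finitely generated, and some \<open>N n\<close> contains all
  its generators.\<close>

lemma ideal_chain_stabilizes:
  fixes N :: "nat \<Rightarrow> 'a set"
  assumes fin: "finite {P :: 'a set. minimal_prime_ideal P}"
    and N: "\<And>i. ring_ideal (N i)" and mono: "\<And>i. N i \<subseteq> N (Suc i)"
  obtains n where "\<And>m. m \<ge> n \<Longrightarrow> N m = N n"
proof -
  have le: "N i \<subseteq> N j" if "i \<le> j" for i j
    using lift_Suc_mono_le[of N] mono that by blast
  have "subset.chain (range N) (range N)"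
    using le by (auto simp: subset_chain_def) (meson linear subsetD)
  then have "ring_ideal (\<Union>(range N))"
    using N by (intro ring_ideal_Union_chain[of _ "range N"]) auto
  then have "fg_ideal (\<Union>(range N))" by (rule every_ideal_fg[OF fin])
  then obtain F where F: "finite F" "\<Union>(range N) = R.span F"
    unfolding fg_ideal_def by blast
  then have "F \<subseteq> \<Union>(range N)" using R.span_superset by blast
  then obtain n where "F \<subseteq> N n"
    using finite_subset_Union_chain[OF F(1), of "range N"] \<open>subset.chain (range N) (range N)\<close> by blast
  then have "\<Union>(range N) \<subseteq> N n" unfolding F(2) using N by (rule ring_span_least)
  then have "N m = N n" if "m \<ge> n" for m using le[OF that] by blast
  then show ?thesis using that by blast
qed

end

section \<open>Residual ideals and multiplication modules\<close>

context module
begin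

lemma submodule_iff_subspace: "submodule scale N \<longleftrightarrow> subspace N"
  by (auto simp: submodule_def subspace_def)

lemma ideal_smult_eq_span: "ideal_smult scale I = span {scale r m | r m. r \<in> I}"
  by (simp add: ideal_smult_def gen_submodule_def span_explicit)

lemma ideal_smult_memI: "r \<in> I \<Longrightarrow> scale r m \<in> ideal_smult scale I"
  unfolding ideal_smult_eq_span by (rule span_base) auto

lemma ideal_smult_subset:
  "subspace N \<Longrightarrow> (\<And>r m. r \<in> I \<Longrightarrow> scale r m \<in> N) \<Longrightarrow> ideal_smult scale I \<subseteq> N"
  unfolding ideal_smult_eq_span by (rule span_minimal) auto

text \<open>The residual ideal \<open>(N : M)\<close>, where \<open>M\<close> is all of
  \<open>'b\<close>.\<close>

definition quotient_ideal :: "'b set \<Rightarrow> 'a set" where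
  "quotient_ideal N = {r. \<forall>m. scale r m \<in> N}"

lemma ring_ideal_quotient_ideal: "subspace N \<Longrightarrow> ring_ideal (quotient_ideal N)"
  unfolding ring_ideal_def quotient_ideal_def
  by (auto simp: scale_left_distrib subspace_0 subspace_add subspace_scale simp flip: scale_scale)

text \<open>If \<open>N = IM\<close> then \<open>I \<subseteq> (N : M)\<close>, so
  \<open>N = IM \<subseteq> (N : M)M \<subseteq> N\<close>.\<close>

lemma ideal_smult_quotient_ideal:
  assumes "multiplication_module scale" "subspace N"
  shows "ideal_smult scale (quotient_ideal N) = N"
proof
  show "ideal_smult scale (quotient_ideal N) \<subseteq> N"
    using assms(2) by (rule ideal_smult_subset) (auto simp: quotient_ideal_def)
  obtain I where I: "N = ideal_smult scale I"
    using assms by (auto simp: multiplication_module_def submodule_iff_subspace)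
  then have "I \<subseteq> quotient_ideal N"
    by (auto simp: quotient_ideal_def ideal_smult_memI)
  then have "ideal_smult scale I \<subseteq> ideal_smult scale (quotient_ideal N)"
    by (intro ideal_smult_subset) (auto simp: ideal_smult_eq_span intro!: span_base)
  then show "N \<subseteq> ideal_smult scale (quotient_ideal N)" using I by simp
qed

text \<open>By \<open>N = (N : M)M\<close> a submodule is determined by its residual ideal, and
  ascending chains of ideals stabilize.\<close>

lemma multiplication_module_noetherian:
  assumes "multiplication_ring TYPE('a)" "finite {P :: 'a set. minimal_prime_ideal P}"
    and mm: "multiplication_module scale"
  shows "noetherian_module scale"
  unfolding noetherian_module_def submodule_iff_subspace
proof (intro allI impI)
  fix N :: "nat \<Rightarrow> 'b set" assume N: "\<forall>i. subspace (N i) \<and> N i \<subseteq> N (Suc i)"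
  have "ring_ideal (quotient_ideal (N i))" "quotient_ideal (N i) \<subseteq> quotient_ideal (N (Suc i))" for i
    using N ring_ideal_quotient_ideal by (auto simp: quotient_ideal_def)
  then obtain n where n: "\<And>m. m \<ge> n \<Longrightarrow> quotient_ideal (N m) = quotient_ideal (N n)"
    using ideal_chain_stabilizes[OF assms(1,2), of "\<lambda>i. quotient_ideal (N i)"] by metis
  have "ideal_smult scale (quotient_ideal (N i)) = N i" for i
    using N by (intro ideal_smult_quotient_ideal[OF mm]) simp
  then have "N m = N n" if "m \<ge> n" for m
    using n[OF that] by metis
  then show "\<exists>n. \<forall>m\<ge>n. N m = N n" by blast
qed

text \<open>For \<open>n = x + y\<close> in \<open>N\<close>, split \<open>n = an + bn\<close>: here
  \<open>an = ax + ay\<close> lies in \<open>M1\<close>, and \<open>bn\<close> in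
  \<open>M2\<close>.\<close>

lemma distributive_moduleI:
  assumes "\<And>x y. \<exists>a b. a + b = 1 \<and> scale a y \<in> span {x} \<and> scale b x \<in> span {y}"
  shows "distributive_module scale"
  unfolding distributive_module_def distributive_submodule_def submodule_iff_subspace
proof (intro allI impI, elim conjE)
  fix N M1 M2 assume N: "subspace N" and M: "subspace M1" "subspace M2"
  show "submod_sum M1 M2 \<inter> N = submod_sum (M1 \<inter> N) (M2 \<inter> N)"
  proof
    show "submod_sum (M1 \<inter> N) (M2 \<inter> N) \<subseteq> submod_sum M1 M2 \<inter> N"
      using N by (auto simp: submod_sum_def subspace_add)
    show "submod_sum M1 M2 \<inter> N \<subseteq> submod_sum (M1 \<inter> N) (M2 \<inter> N)"
    proof
      fix n assume "n \<in> submod_sum M1 M2 \<inter> N"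
      then obtain x y where n: "n = x + y" "x \<in> M1" "y \<in> M2" "n \<in> N"
        by (auto simp: submod_sum_def)
      obtain a b where ab: "a + b = 1" "scale a y \<in> span {x}" "scale b x \<in> span {y}"
        using assms by blast
      have "span {x} \<subseteq> M1" "span {y} \<subseteq> M2" using n M by (simp_all add: span_minimal)
      then have "scale a y \<in> M1" "scale b x \<in> M2" using ab by auto
      then have "scale a n \<in> M1" "scale b n \<in> M2"
        using n M by (simp_all add: scale_right_distrib subspace_add subspace_scale)
      moreover have "scale a n \<in> N" "scale b n \<in> N" using n N by (auto intro: subspace_scale)
      moreover have "n = scale a n + scale b n"
        using ab(1) by (simp flip: scale_left_distrib)
      ultimately show "n \<in> submod_sum (M1 \<inter> N) (M2 \<inter> N)"
        unfolding submod_sum_def by blast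
    qed
  qed
qed

text \<open>For \<open>(Rx : M)\<close> and \<open>(Ry : M)\<close>,
  \<open>ideal_quotients_comaximal\<close> gives \<open>a + b = 1\<close>;
  \<open>a (Ry : M) \<subseteq> (Rx : M)\<close> yields \<open>a y \<in> Rx\<close>, because
  \<open>Ry = (Ry : M)M\<close>.\<close>

lemma multiplication_module_distributive:
  assumes "multiplication_ring TYPE('a)" "finite {P :: 'a set. minimal_prime_ideal P}"
    and mm: "multiplication_module scale"
  shows "distributive_module scale"
proof (rule distributive_moduleI)
  have transfer: "scale c y \<in> span {x}"
    if "\<And>r. r \<in> quotient_ideal (span {y}) \<Longrightarrow> c * r \<in> quotient_ideal (span {x})" for c x y
  proof -
    have "ideal_smult scale (quotient_ideal (span {y})) \<subseteq> {z. scale c z \<in> span {x}}"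
    proof (rule ideal_smult_subset)
      show "subspace {z. scale c z \<in> span {x}}"
        by (auto simp: subspace_def scale_right_distrib span_zero span_add scale_left_commute[of c] span_scale
            simp del: scale_scale)
      show "scale r m \<in> {z. scale c z \<in> span {x}}" if "r \<in> quotient_ideal (span {y})" for r m
        using \<open>\<And>r. _ \<Longrightarrow> c * r \<in> _\<close>[OF that] by (simp add: quotient_ideal_def)
    qed
    then have "span {y} \<subseteq> {z. scale c z \<in> span {x}}"
      using ideal_smult_quotient_ideal[OF mm subspace_span] by simp
    then show ?thesis using span_base[of y "{y}"] by blast
  qed
  fix x y
  have "ring_ideal (quotient_ideal (span {x}))" "ring_ideal (quotient_ideal (span {y}))"
    by (simp_all add: ring_ideal_quotient_ideal)
  then obtain a b where "a + b = 1"
    "\<And>r. r \<in> quotient_ideal (span {y}) \<Longrightarrow> a * r \<in> quotient_ideal (span {x})"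
    "\<And>r. r \<in> quotient_ideal (span {x}) \<Longrightarrow> b * r \<in> quotient_ideal (span {y})"
    using ideal_quotients_comaximal[OF assms(1,2)] by metis
  then show "\<exists>a b. a + b = 1 \<and> scale a y \<in> span {x} \<and> scale b x \<in> span {y}"
    using transfer by blast
qed

section \<open>Noetherian distributive modules\<close>

text \<open>Apply distributivity to \<open>(Rx + Ry) \<inter> R(x + y)\<close>.\<close>
lemma distributive_module_comaximal:
  assumes "distributive_module scale"
  obtains a b where "a + b = 1" "scale a y \<in> span {x}" "scale b x \<in> span {y}"
proof -
  have "submod_sum (span {x}) (span {y}) \<inter> span {x + y}
      = submod_sum (span {x} \<inter> span {x + y}) (span {y} \<inter> span {x + y})"
    using assms
    unfolding distributive_module_def distributive_submodule_def submodule_iff_subspace by simp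
  moreover have "x + y \<in> submod_sum (span {x}) (span {y}) \<inter> span {x + y}"
    by (auto simp: submod_sum_def intro: span_base)
  ultimately have "x + y \<in> submod_sum (span {x} \<inter> span {x + y}) (span {y} \<inter> span {x + y})"
    by (simp only:)
  then obtain u v where uv: "x + y = u + v" "u \<in> span {x}" "u \<in> span {x + y}"
    "v \<in> span {y}" "v \<in> span {x + y}"
    unfolding submod_sum_def by blast
  obtain a b where ab: "u = scale a (x + y)" "v = scale b (x + y)"
    using uv(3,5) unfolding span_singleton by blast
  \<comment> \<open>The remaining part \<open>c\<close> of 1 annihilates \<open>x + y\<close>, so
    \<open>c y = - c x\<close> lies in \<open>Rx\<close>; it is absorbed into
    \<open>a\<close>.\<close>
  define c where "c = 1 - a - b"
  have "scale (a + b) (x + y) = x + y"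
    using uv(1) unfolding ab by (metis scale_left_distrib)
  moreover have "c = 1 - (a + b)" by (simp add: c_def)
  ultimately have "scale c (x + y) = 0" by (simp only: scale_left_diff_distrib scale_one diff_self)
  then have c: "scale c y = - scale c x"
    by (simp add: scale_right_distrib eq_neg_iff_add_eq_0 add.commute)
  have xs: "scale r x \<in> span {x}" "scale r y \<in> span {y}" for r
    by (auto intro: span_scale span_base)
  \<comment> \<open>Since \<open>u \<in> Rx\<close> and \<open>u = ax + ay\<close>, also
    \<open>ay \<in> Rx\<close>; likewise \<open>bx \<in> Ry\<close>.\<close>
  have "scale a y = u - scale a x" "scale b x = v - scale b y"
    unfolding ab by (simp_all add: scale_right_distrib)
  then have mem: "scale a y \<in> span {x}" "scale b x \<in> span {y}"
    using uv xs by (auto intro: span_diff)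
  have "scale c y \<in> span {x}" unfolding c using xs by (auto intro: span_neg)
  then have "scale (a + c) y \<in> span {x}"
    using mem by (auto simp: scale_left_distrib intro: span_add)
  then show ?thesis using that[of "a + c" b] mem by (simp add: c_def)
qed

text \<open>Otherwise adjoining an element outside the current span, again and again, gives a
  strictly increasing chain.\<close>

lemma noetherian_imp_fg:
  assumes "noetherian_module scale"
  obtains F where "finite F" "span F = UNIV"
proof (rule ccontr)
  assume "\<not> thesis"
  then have "\<exists>x. x \<notin> span F" if "finite F" for F
    using \<open>\<And>F. finite F \<Longrightarrow> span F = UNIV \<Longrightarrow> thesis\<close> that by blast
  then obtain g where g: "\<And>F. finite F \<Longrightarrow> g F \<notin> span F" by metis
  define X where "X = rec_nat {} (\<lambda>_ F. insert (g F) F)"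
  have X: "X (Suc i) = insert (g (X i)) (X i)" for i by (simp add: X_def)
  have fin: "finite (X i)" for i by (induction i) (auto simp: X_def)
  have "\<forall>i. submodule scale (span (X i)) \<and> span (X i) \<subseteq> span (X (Suc i))"
    by (auto simp: submodule_iff_subspace X intro!: span_mono)
  then obtain n where "\<forall>m\<ge>n. span (X m) = span (X n)"
    using assms[unfolded noetherian_module_def] by (meson)
  then have "span (X (Suc n)) = span (X n)" using le_SucI by blast
  moreover have "g (X n) \<in> span (X (Suc n))" unfolding X by (rule span_base) simp
  ultimately show False using g[OF fin] by blast
qed

text \<open>When \<open>y\<close> joins \<open>F\<close>, one of \<open>a\<close>, \<open>b\<close>
  is outside \<open>P\<close>: if \<open>a\<close>, the local generator \<open>x\<close> is kept;
  otherwise \<open>y\<close> replaces it.\<close>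

lemma locally_cyclic_at_prime:
  assumes dist: "distributive_module scale" and P: "prime_ideal P" and F: "finite F"
  shows "\<exists>s x. s \<notin> P \<and> (\<forall>m\<in>F. scale s m \<in> span {x})"
  using F
proof (induction F)
  case empty
  then show ?case using one_notin_prime_ideal[OF P] by blast
next
  case (insert y F)
  then obtain s x where s: "s \<notin> P" "\<forall>m\<in>F. scale s m \<in> span {x}" by blast
  obtain a b where ab: "a + b = 1" "scale a y \<in> span {x}" "scale b x \<in> span {y}"
    using distributive_module_comaximal[OF dist] .
  consider "a \<notin> P" | "b \<notin> P"
    using ab(1) one_notin_prime_ideal[OF P] ring_ideal_add[OF prime_ideal_imp_ideal[OF P]] by metis
  then show ?case
  proof cases
    case 1
    then have "s * a \<notin> P" using s prime_idealD[OF P] by blast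
    moreover have "scale (s * a) m \<in> span {x}" if "m \<in> insert y F" for m
      using that s ab(2) span_scale[of "scale s m" "{x}" a] span_scale[of "scale a y" "{x}" s]
      by (auto simp: mult.commute)
    ultimately show ?thesis by blast
  next
    case 2
    then have "b * s \<notin> P" using s prime_idealD[OF P] by blast
    moreover have "scale (b * s) m \<in> span {y}" if "m \<in> insert y F" for m
    proof (cases "m = y")
      case True
      then show ?thesis by (auto intro: span_scale span_base)
    next
      case False
      then have "scale s m \<in> span {x}" using that s(2) by simp
      then obtain k where k: "scale s m = scale k x" unfolding span_singleton by blast
      have "scale (b * s) m = scale b (scale k x)" by (simp flip: k)
      then have "scale (b * s) m = scale k (scale b x)" by (simp only: scale_left_commute)
      then show ?thesis using span_scale[OF ab(3), of k] by (simp only:)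
    qed
    ultimately show ?thesis by blast
  qed
qed

text \<open>If \<open>sM \<subseteq> Rx\<close>, \<open>n \<in> N\<close> and \<open>sn = rx\<close>, then \<open>rs \<in> (N : M)\<close>, whence \<open>s\<^sup>2 n \<in> (N : M)M\<close>.\<close>
lemma noetherian_distributive_imp_multiplication:
  assumes noeth: "noetherian_module scale" and dist: "distributive_module scale"
  shows "multiplication_module scale"
  unfolding multiplication_module_def submodule_iff_subspace
proof (intro allI impI)
  fix N assume N: "subspace N"
  let ?I = "quotient_ideal N"
  let ?N = "ideal_smult scale ?I"
  obtain F where F: "finite F" "span F = UNIV" using noetherian_imp_fg[OF noeth] .
  have sub: "subspace ?N" by (simp add: ideal_smult_eq_span)
  have "n \<in> ?N" if n: "n \<in> N" for n
  proof (rule ccontr)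
    assume "n \<notin> ?N"
    \<comment> \<open>If \<open>n\<close> is outside \<open>?N\<close>, this ideal is proper, and a
      prime above it contains every \<open>c\<close> with \<open>c n \<in> ?N\<close>; the
      contradiction is such a \<open>c\<close> outside the prime, namely
      \<open>s * s\<close>.\<close>
    let ?J = "{c. scale c n \<in> ?N}"
    have "ring_ideal ?J"
      using sub unfolding ring_ideal_def
      by (auto simp: scale_left_distrib subspace_0 subspace_add subspace_scale simp flip: scale_scale)
    moreover have "1 \<notin> ?J" using \<open>n \<notin> ?N\<close> by simp
    ultimately obtain P where P: "prime_ideal P" "?J \<subseteq> P"
      using ex_prime_ideal_above by blast
    obtain s x where s: "s \<notin> P" "\<forall>m\<in>F. scale s m \<in> span {x}"
      using locally_cyclic_at_prime[OF dist P(1) F(1)] by blast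
    have "span F \<subseteq> {m. scale s m \<in> span {x}}"
      using s(2) by (intro span_minimal)
        (auto simp: subspace_def scale_right_distrib span_zero span_add scale_left_commute[of s] span_scale
            simp del: scale_scale)
    then have sM: "\<exists>k. scale s m = scale k x" for m
      using F(2) by (auto simp: span_singleton)
    then obtain r where r: "scale s n = scale r x" by blast
    \<comment> \<open>With \<open>s m = k x\<close>, one has \<open>r s m = k r x = k s n\<close>,
      which is in \<open>N\<close>.\<close>
    have "scale (r * s) m \<in> N" for m
    proof -
      obtain k where "scale s m = scale k x" using sM by blast
      then have "scale (r * s) m = scale (k * s) n"
        using r by (metis scale_scale mult.commute)
      then show ?thesis using N n by (simp add: subspace_scale)
    qed
    then have "r * s \<in> ?I" by (simp add: quotient_ideal_def)
    then have "scale (r * s) x \<in> ?N" by (rule ideal_smult_memI)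
    moreover have "scale (s * s) n = scale (r * s) x"
      using r by (metis scale_scale mult.commute)
    ultimately have "s * s \<in> P" using P by auto
    then show False using s prime_idealD[OF P(1)] by blast
  qed
  moreover have "?N \<subseteq> N"
    using N by (rule ideal_smult_subset) (auto simp: quotient_ideal_def)
  ultimately have "N = ?N" by blast
  then show "\<exists>I. ring_ideal I \<and> N = ideal_smult scale I"
    using ring_ideal_quotient_ideal[OF N] by blast
qed

end

theorem theorem1p5:
  fixes scale :: "'a::comm_ring_1 \<Rightarrow> 'b::ab_group_add \<Rightarrow> 'b"
  assumes "multiplication_ring TYPE('a)"
    and "finite {P :: 'a set. minimal_prime_ideal P}"
    and "module scale"
  shows "(faithful_module scale \<and> noetherian_module scale \<and> distributive_module scale)
     \<longleftrightarrow> (faithful_module scale \<and> multiplication_module scale)"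
  using module.noetherian_distributive_imp_multiplication[OF assms(3)]
    module.multiplication_module_noetherian[OF assms(3,1,2)]
    module.multiplication_module_distributive[OF assms(3,1,2)]
  by blast

end
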